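(* Let $(X,d)$ and $(Y,e)$ be metric spaces, $E\subseteq X$, $f:E\to Y$. Let $K,L\subseteq\mathbb N$ and $\alpha:K\to X$, $\beta:L\to Y$ with $\mathrm{rng}(\alpha)$ dense in $X$ and $\mathrm{rng}(\beta)$ dense in $Y$; let $r_0,r_1,\ldots$ be a computable sequence of positive rationals having $0$ as an accumulation point; let $\langle\cdot,\cdot\rangle:\mathbb N^2\to\mathbb N$ be a computable bijection, $I=\{\langle k,m\rangle\mid k\in K,m\in\mathbb N\}$, $J=\{\langle l,n\rangle\mid l\in L,n\in\mathbb N\}$, $U_{\langle k,m\rangle}=B_d(\alpha(k),r_m)$ and $V_{\langle l,n\rangle}=B_e(\beta(l),r_n)$, $\mathcal U=\{U_i\}_{i\in I}$, $\mathcal V=\{V_j\}_{j\in J}$. If there exists a recursively enumerable topological $(\alpha,\beta)$-approximation system for $f$, then $f$ is $(\mathcal U,\mathcal V)$-computable.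
   Context: $B_d(x,r)=\{\bar x\in X\mid d(x,\bar x)<r\}$, similarly $B_e$. A topological $(\alpha,\beta)$-approximation system for $f$ is a subset $S\subseteq K\times\mathbb N\times L\times\mathbb N$ such that for every $x\in E$ and every $(l,n)\in L\times\mathbb N$: $e(\beta(l),f(x))<r_n$ iff there exist $k,m$ with $(k,m,l,n)\in S$ and $d(\alpha(k),x)<r_m$. For $x\in X$ let $[x]_{\mathcal U}=\{i\in I\mid x\in U_i\}$, for $y\in Y$ let $[y]_{\mathcal V}=\{j\in J\mid y\in V_j\}$; $f$ is $(\mathcal U,\mathcal V)$-computable if there is an enumeration operator $F:\mathcal P(\mathbb N)\to\mathcal P(\mathbb N)$ with $[f(x)]_{\mathcal V}=F([x]_{\mathcal U})$ for all $x\in E$. *)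

theory Defs
  imports "HOL-Analysis.Abstract_Metric_Spaces" "HOL-Library.Nat_Bijection"
begin

text \<open>Total recursive functions of \<open>n\<close> arguments in Kleene's sense (closure under composition,
  primitive recursion and minimization of regular functions). An \<open>n\<close>-ary function is represented by
  its action on lists of length \<open>n\<close>; rule \<open>cong\<close> makes the values on other lists irrelevant.\<close>

inductive recursive :: "nat \<Rightarrow> (nat list \<Rightarrow> nat) \<Rightarrow> bool" where
  zero: "recursive n (\<lambda>xs. 0)"
| suc: "recursive 1 (\<lambda>xs. Suc (hd xs))"
| proj: "i < n \<Longrightarrow> recursive n (\<lambda>xs. xs ! i)"
| comp: "recursive (length hs) g \<Longrightarrow> (\<forall>h\<in>set hs. recursive n h)
    \<Longrightarrow> recursive n (\<lambda>xs. g (map (\<lambda>h. h xs) hs))"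
| prec: "recursive n g \<Longrightarrow> recursive (n + 2) h
    \<Longrightarrow> recursive (n + 1) (\<lambda>xs. rec_nat (g (tl xs)) (\<lambda>y v. h (y # v # tl xs)) (hd xs))"
| mu: "recursive (n + 1) g \<Longrightarrow> (\<forall>xs. length xs = n \<longrightarrow> (\<exists>y. g (y # xs) = 0))
    \<Longrightarrow> recursive n (\<lambda>xs. LEAST y. g (y # xs) = 0)"
| cong: "recursive n g \<Longrightarrow> (\<forall>xs. length xs = n \<longrightarrow> h xs = g xs) \<Longrightarrow> recursive n h"

definition computable1 :: "(nat \<Rightarrow> nat) \<Rightarrow> bool" where
  "computable1 g \<longleftrightarrow> recursive 1 (\<lambda>xs. g (xs ! 0))"

definition computable2 :: "(nat \<Rightarrow> nat \<Rightarrow> nat) \<Rightarrow> bool" where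
  "computable2 g \<longleftrightarrow> recursive 2 (\<lambda>xs. g (xs ! 0) (xs ! 1))"

text \<open>A subset of \<open>\<nat>\<^sup>k\<close> (tuples as lists of length \<open>k\<close>) is recursively enumerable if it is empty or
  enumerated by a recursive function \<open>\<nat> \<rightarrow> \<nat>\<^sup>k\<close>, i.e.\ by \<open>k\<close> recursive component functions.\<close>

definition rec_enumerable :: "nat \<Rightarrow> nat list set \<Rightarrow> bool" where
  "rec_enumerable k A \<longleftrightarrow> A = {} \<or>
     (\<exists>gs. length gs = k \<and> (\<forall>g\<in>set gs. computable1 g) \<and> A = range (\<lambda>t. map (\<lambda>g. g t) gs))"

definition rec_enumerable2 :: "(nat \<times> nat) set \<Rightarrow> bool" where
  "rec_enumerable2 W \<longleftrightarrow> rec_enumerable 2 {[a, b] | a b. (a, b) \<in> W}"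

definition rec_enumerable4 :: "(nat \<times> nat \<times> nat \<times> nat) set \<Rightarrow> bool" where
  "rec_enumerable4 S \<longleftrightarrow> rec_enumerable 4 {[a, b, c, d] | a b c d. (a, b, c, d) \<in> S}"

definition computable_rat_seq :: "(nat \<Rightarrow> rat) \<Rightarrow> bool" where
  "computable_rat_seq r \<longleftrightarrow>
     (\<exists>a b c. computable1 a \<and> computable1 b \<and> computable1 c \<and>
        (\<forall>n. c n \<noteq> 0 \<and> r n = (of_nat (a n) - of_nat (b n)) / of_nat (c n)))"

text \<open>Accumulation point of a sequence: every neighbourhood contains infinitely many terms,
  counted by their indices.\<close>

definition seq_accumulation_point :: "(nat \<Rightarrow> 'a::topological_space) \<Rightarrow> 'a \<Rightarrow> bool" where
  "seq_accumulation_point s a \<longleftrightarrow>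
     (\<forall>T. open T \<longrightarrow> a \<in> T \<longrightarrow> (\<exists>\<^sub>F n in sequentially. s n \<in> T))"

text \<open>Enumeration operators in the sense of Friedberg and Rogers; \<^const>\<open>set_decode\<close> \<open>u\<close> is the finite
  set with canonical index \<open>u\<close>.\<close>

definition enumeration_operator :: "(nat set \<Rightarrow> nat set) \<Rightarrow> bool" where
  "enumeration_operator F \<longleftrightarrow>
     (\<exists>W. rec_enumerable2 W \<and> (\<forall>A. F A = {j. \<exists>u. (u, j) \<in> W \<and> set_decode u \<subseteq> A}))"

definition nbhd_indices :: "nat set \<Rightarrow> (nat \<Rightarrow> 'a set) \<Rightarrow> 'a \<Rightarrow> nat set" where
  "nbhd_indices I U x = {i \<in> I. x \<in> U i}"

definition UV_computable ::
  "nat set \<Rightarrow> (nat \<Rightarrow> 'a set) \<Rightarrow> nat set \<Rightarrow> (nat \<Rightarrow> 'b set) \<Rightarrow> 'a set \<Rightarrow> ('a \<Rightarrow> 'b) \<Rightarrow> bool" where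
  "UV_computable I U J V E f \<longleftrightarrow>
     (\<exists>F. enumeration_operator F \<and> (\<forall>x\<in>E. nbhd_indices J V (f x) = F (nbhd_indices I U x)))"

definition top_approx_system ::
  "('a \<Rightarrow> 'a \<Rightarrow> real) \<Rightarrow> ('b \<Rightarrow> 'b \<Rightarrow> real) \<Rightarrow> nat set \<Rightarrow> (nat \<Rightarrow> 'a) \<Rightarrow> nat set \<Rightarrow> (nat \<Rightarrow> 'b) \<Rightarrow>
   (nat \<Rightarrow> rat) \<Rightarrow> 'a set \<Rightarrow> ('a \<Rightarrow> 'b) \<Rightarrow> (nat \<times> nat \<times> nat \<times> nat) set \<Rightarrow> bool" where
  "top_approx_system d e K \<alpha> L \<beta> r E f S \<longleftrightarrow>
     S \<subseteq> K \<times> UNIV \<times> L \<times> UNIV \<and>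
     (\<forall>x\<in>E. \<forall>l\<in>L. \<forall>n. e (\<beta> l) (f x) < real_of_rat (r n) \<longleftrightarrow>
        (\<exists>k m. (k, m, l, n) \<in> S \<and> d (\<alpha> k) x < real_of_rat (r m)))"

end

theory Submission
  imports Defs
begin

text \<open>If \<open>S\<close> is a recursively enumerable approximation system, then the set of all pairs
  \<open>(u, \<langle>l, n\<rangle>)\<close>, where \<open>u = 2 ^ \<langle>k, m\<rangle>\<close> is the canonical index of the singleton \<open>{\<langle>k, m\<rangle>}\<close> and
  \<open>(k, m, l, n) \<in> S\<close>, is recursively enumerable. The defining equivalence of an approximation system
  says precisely that the enumeration operator given by this set maps the neighbourhood indices of
  \<open>x\<close> to those of \<open>f x\<close>.\<close>

lemma recursive_comp1:
  assumes "computable1 g" and "recursive n h"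
  shows "recursive n (\<lambda>xs. g (h xs))"
  using recursive.comp[of "[h]" "\<lambda>xs. g (xs ! 0)" n] assms
  by (simp add: computable1_def)

lemma recursive_comp2:
  assumes "computable2 g" and "recursive n h1" and "recursive n h2"
  shows "recursive n (\<lambda>xs. g (h1 xs) (h2 xs))"
  using recursive.comp[of "[h1, h2]" "\<lambda>xs. g (xs ! 0) (xs ! 1)" n] assms
  by (simp add: computable2_def numeral_2_eq_2)

lemma computable1_comp1: "computable1 g \<Longrightarrow> computable1 h \<Longrightarrow> computable1 (\<lambda>t. g (h t))"
  using recursive_comp1[of g 1 "\<lambda>xs. h (xs ! 0)"] by (simp add: computable1_def)

lemma computable1_comp2:
  "computable2 g \<Longrightarrow> computable1 h1 \<Longrightarrow> computable1 h2 \<Longrightarrow> computable1 (\<lambda>t. g (h1 t) (h2 t))"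
  using recursive_comp2[of g 1 "\<lambda>xs. h1 (xs ! 0)" "\<lambda>xs. h2 (xs ! 0)"]
  by (simp add: computable1_def)

lemma computable1_Suc: "computable1 Suc"
  unfolding computable1_def
  \<comment> \<open>\<open>suc\<close> is stated with \<open>hd\<close>, \<open>computable1\<close>
    with index 0; rule \<open>cong\<close> only asks for agreement on lists of length 1, which are
    nonempty.\<close>
  by (rule recursive.cong[OF recursive.suc]) (simp add: hd_conv_nth flip: length_greater_0_conv)

text \<open>Primitive recursion on the first summand: start with the second summand and apply the
  successor once per step.\<close>

lemma computable2_plus: "computable2 (+)"
proof -
  \<comment> \<open>The step function receives the list \<open>y # v # tl xs\<close>, so index 1
    picks the previous value \<open>v\<close>.\<close>
  have "recursive (1 + 2) (\<lambda>xs. Suc (xs ! 1))"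
    by (intro recursive_comp1[OF computable1_Suc] recursive.proj) simp
  from recursive.prec[OF recursive.proj[of 0 1] this]
  have "recursive 2 (\<lambda>xs. rec_nat (tl xs ! 0) (\<lambda>y v. Suc v) (hd xs))"
    by (simp add: numeral_2_eq_2)
  then show ?thesis
    unfolding computable2_def
  proof (rule recursive.cong, intro allI impI)
    fix xs :: "nat list"
    assume "length xs = 2"
    then obtain a b where xs: "xs = [a, b]"
      by (auto simp: numeral_2_eq_2 length_Suc_conv)
    have "rec_nat b (\<lambda>y v. Suc v) a = a + b"
      by (induction a) auto
    then show "xs ! 0 + xs ! 1 = rec_nat (tl xs ! 0) (\<lambda>y v. Suc v) (hd xs)"
      by (simp add: xs)
  qed
qed

text \<open>Repeated doubling, starting from 1. With no parameters besides the recursion variable,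
  the base value is a function of arity 0.\<close>

lemma computable1_power2: "computable1 (\<lambda>t. 2 ^ t)"
proof -
  have one: "recursive 0 (\<lambda>xs. Suc 0)"
    by (rule recursive_comp1[OF computable1_Suc recursive.zero])
  have "recursive (0 + 2) (\<lambda>xs. xs ! 1 + xs ! 1)"
    by (intro recursive_comp2[OF computable2_plus] recursive.proj) simp_all
  from recursive.prec[OF one this]
  have "recursive 1 (\<lambda>xs. rec_nat (Suc 0) (\<lambda>y v. v + v) (hd xs))"
    by simp
  then show ?thesis
    unfolding computable1_def
  proof (rule recursive.cong, intro allI impI)
    fix xs :: "nat list"
    assume "length xs = 1"
    then obtain a where xs: "xs = [a]"
      by (auto simp: length_Suc_conv)
    have "rec_nat (Suc 0) (\<lambda>y v. v + v) a = 2 ^ a"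
      by (induction a) auto
    then show "2 ^ (xs ! 0) = rec_nat (Suc 0) (\<lambda>y v. v + v) (hd xs)"
      by (simp add: xs)
  qed
qed

text \<open>The canonical index of a finite set is the sum of the powers of 2 with exponents in it,
  a single power for a singleton.\<close>

lemma set_decode_power2: "set_decode (2 ^ n) = {n}"
  using set_encode_inverse[of "{n}"] by (simp add: set_encode_def)

lemma rec_enumerable2_range:
  "computable1 g \<Longrightarrow> computable1 h \<Longrightarrow> rec_enumerable2 (range (\<lambda>t. (g t, h t)))"
  unfolding rec_enumerable2_def rec_enumerable_def
  by (intro disjI2 exI[of _ "[g, h]"]) auto

text \<open>Passes from lists of length 4 back to quadruples; nothing is lost because the encoding
  of quadruples as lists is injective.\<close>

lemma rec_enumerable4_cases:
  assumes "rec_enumerable4 S"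
  obtains "S = {}"
  | a b c d where "computable1 a" "computable1 b" "computable1 c" "computable1 d"
      "S = range (\<lambda>t. (a t, b t, c t, d t))"
proof -
  let ?A = "{[a, b, c, d] | a b c d. (a, b, c, d) \<in> S}"
  from assms consider "?A = {}"
    | gs where "length gs = 4" "\<forall>g\<in>set gs. computable1 g" "?A = range (\<lambda>t. map (\<lambda>g. g t) gs)"
    unfolding rec_enumerable4_def rec_enumerable_def by blast
  then show thesis
  proof cases
    case 1
    then have "S = {}" by auto
    then show thesis by (rule that(1))
  next
    case (2 gs)
    then obtain a b c d where gs: "gs = [a, b, c, d]"
      by (auto simp: numeral_eq_Suc length_Suc_conv)
    have A: "?A = range (\<lambda>t. [a t, b t, c t, d t])"
      using 2(3) by (simp add: gs)
    have "(k, m, l, n) \<in> S \<longleftrightarrow> (k, m, l, n) \<in> range (\<lambda>t. (a t, b t, c t, d t))" for k m l n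
    proof -
      have "(k, m, l, n) \<in> S \<longleftrightarrow> [k, m, l, n] \<in> ?A" by simp
      also have "\<dots> \<longleftrightarrow> (k, m, l, n) \<in> range (\<lambda>t. (a t, b t, c t, d t))"
        unfolding A by auto
      finally show ?thesis .
    qed
    then have "S = range (\<lambda>t. (a t, b t, c t, d t))" by auto
    with 2(2) show thesis by (intro that(2)[of a b c d]) (simp_all add: gs)
  qed
qed

text \<open>An enumeration of \<open>S\<close> is turned into one of the new set by composing its
  components with computable functions. Empty \<open>S\<close> is separate, having no
  enumeration.\<close>

lemma rec_enumerable2_singleton_indices:
  assumes "rec_enumerable4 S" and "computable2 pr"
  shows "rec_enumerable2 {(2 ^ pr k m, pr l n) | k m l n. (k, m, l, n) \<in> S}"
  using assms(1)
proof (cases rule: rec_enumerable4_cases)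
  case 1
  then show ?thesis by (simp add: rec_enumerable2_def rec_enumerable_def)
next
  case (2 a b c d)
  have "rec_enumerable2 (range (\<lambda>t. (2 ^ pr (a t) (b t), pr (c t) (d t))))"
    by (rule rec_enumerable2_range[OF computable1_comp1[OF computable1_power2
          computable1_comp2[OF assms(2) 2(1,2)]] computable1_comp2[OF assms(2) 2(3,4)]])
  also have "range (\<lambda>t. ((2::nat) ^ pr (a t) (b t), pr (c t) (d t)))
      = {(2 ^ pr k m, pr l n) | k m l n. (k, m, l, n) \<in> S}"
    unfolding 2(5) by blast
  finally show ?thesis .
qed

theorem theorem3p4:
  fixes X :: "'a set" and d :: "'a \<Rightarrow> 'a \<Rightarrow> real"
    and Y :: "'b set" and e :: "'b \<Rightarrow> 'b \<Rightarrow> real"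
    and E :: "'a set" and f :: "'a \<Rightarrow> 'b"
    and K L I J :: "nat set"
    and \<alpha> :: "nat \<Rightarrow> 'a" and \<beta> :: "nat \<Rightarrow> 'b"
    and r :: "nat \<Rightarrow> rat"
    and pr :: "nat \<Rightarrow> nat \<Rightarrow> nat"
    and U :: "nat \<Rightarrow> 'a set" and V :: "nat \<Rightarrow> 'b set"
  assumes "Metric_space X d" and "Metric_space Y e"
    and "E \<subseteq> X" and "f \<in> E \<rightarrow> Y"
    and "\<alpha> \<in> K \<rightarrow> X" and "\<beta> \<in> L \<rightarrow> Y"
    and "Metric_space.mtopology X d closure_of (\<alpha> ` K) = X"
    and "Metric_space.mtopology Y e closure_of (\<beta> ` L) = Y"
    and "computable_rat_seq r" and "\<forall>n. r n > 0"
    and "seq_accumulation_point (\<lambda>n. real_of_rat (r n)) 0"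
    and "computable2 pr" and "bij (\<lambda>(k, m). pr k m)"
    and "I = {pr k m | k m. k \<in> K}" and "J = {pr l n | l n. l \<in> L}"
    and "\<forall>k\<in>K. \<forall>m. U (pr k m) = Metric_space.mball X d (\<alpha> k) (real_of_rat (r m))"
    and "\<forall>l\<in>L. \<forall>n. V (pr l n) = Metric_space.mball Y e (\<beta> l) (real_of_rat (r n))"
    and "\<exists>S. rec_enumerable4 S \<and> top_approx_system d e K \<alpha> L \<beta> r E f S"
  shows "UV_computable I U J V E f"
proof -
  interpret X: Metric_space X d by fact
  interpret Y: Metric_space Y e by fact
  obtain S where S: "rec_enumerable4 S" and sys: "top_approx_system d e K \<alpha> L \<beta> r E f S"
    using assms by blast
  have sub: "k \<in> K \<and> l \<in> L" if "(k, m, l, n) \<in> S" for k m l n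
    using that sys unfolding top_approx_system_def by blast
  have approx: "e (\<beta> l) (f x) < real_of_rat (r n) \<longleftrightarrow>
      (\<exists>k m. (k, m, l, n) \<in> S \<and> d (\<alpha> k) x < real_of_rat (r m))" if "x \<in> E" "l \<in> L" for x l n
    using that sys unfolding top_approx_system_def by blast
  \<comment> \<open>Membership in \<open>I\<close> or \<open>J\<close> only asserts that some
    decomposition of the index exists; injectivity identifies it with the given one.\<close>
  have inj: "pr k m = pr k' m' \<longleftrightarrow> k = k' \<and> m = m'" for k m k' m'
    using bij_is_inj[OF \<open>bij (\<lambda>(k, m). pr k m)\<close>] by (auto dest: injD[of _ "(k, m)" "(k', m')"])
  define W :: "(nat \<times> nat) set" where "W = {(2 ^ pr k m, pr l n) | k m l n. (k, m, l, n) \<in> S}"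
  define F where "F A = {j. \<exists>u. (u, j) \<in> W \<and> set_decode u \<subseteq> A}" for A
  \<comment> \<open>Every first component in \<open>W\<close> codes a singleton, so the inclusion in
    \<open>A\<close> collapses to membership of one index.\<close>
  have F: "F A = {pr l n | k m l n. (k, m, l, n) \<in> S \<and> pr k m \<in> A}" for A
  proof (intro set_eqI iffI)
    fix j
    assume "j \<in> F A"
    then obtain k m l n
      where "j = pr l n" "(k, m, l, n) \<in> S" "set_decode (2 ^ pr k m) \<subseteq> A"
      unfolding F_def W_def by blast
    then show "j \<in> {pr l n | k m l n. (k, m, l, n) \<in> S \<and> pr k m \<in> A}"
      unfolding set_decode_power2 by blast
  next
    fix j
    assume "j \<in> {pr l n | k m l n. (k, m, l, n) \<in> S \<and> pr k m \<in> A}"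
    then obtain k m l n where "j = pr l n" "(k, m, l, n) \<in> S" "pr k m \<in> A"
      by blast
    then have "(2 ^ pr k m, j) \<in> W" and "set_decode (2 ^ pr k m) \<subseteq> A"
      by (auto simp: W_def set_decode_power2)
    then show "j \<in> F A"
      unfolding F_def by blast
  qed
  have "rec_enumerable2 W"
    unfolding W_def using S \<open>computable2 pr\<close> by (rule rec_enumerable2_singleton_indices)
  then have "enumeration_operator F"
    unfolding enumeration_operator_def F_def by blast
  moreover have "nbhd_indices J V (f x) = F (nbhd_indices I U x)" if "x \<in> E" for x
  proof -
    \<comment> \<open>A point of \<open>mball\<close> must lie in the carrier, as must the centre;
      once both are known, only the distance inequality remains.\<close>
    have "x \<in> X" and "f x \<in> Y"
      using that assms(3,4) by auto
    then have inU: "pr k m \<in> nbhd_indices I U x \<longleftrightarrow> d (\<alpha> k) x < real_of_rat (r m)"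
      if "k \<in> K" for k m
      using that assms(5,14,16) by (auto simp: nbhd_indices_def inj)
    have "nbhd_indices J V (f x)
        = {pr l n | l n. l \<in> L \<and> e (\<beta> l) (f x) < real_of_rat (r n)}"
      using \<open>f x \<in> Y\<close> assms(6,15,17) by (auto simp: nbhd_indices_def inj)
    \<comment> \<open>\<open>approx\<close> requires l \<in> L: on the left this is given, on the
      right it follows from membership in \<open>S\<close>. In the next step \<open>sub\<close>
      likewise supplies the k \<in> K that \<open>inU\<close> requires.\<close>
    also have "\<dots> = {pr l n | k m l n. (k, m, l, n) \<in> S \<and> d (\<alpha> k) x < real_of_rat (r m)}"
      using approx[OF that] sub by blast
    also have "\<dots> = F (nbhd_indices I U x)"
      unfolding F using inU sub by blast
    finally show ?thesis .
  qed
  ultimately show ?thesis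
    unfolding UV_computable_def by blast
qed

end
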